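(* Let $S$, $T_{1}$ and $T_{2}$ be pairwise disjoint finite sets with $1\leq |S|\leq |T_{1}|+|T_{2}|$ and $|T_{1}|+\frac{2}{3}|T_{2}|\leq \frac{4}{3}|S|+\frac{1}{3}$, and set $T=T_{1}\cup T_{2}$. Let $G$ be a simple bipartite graph with bipartition $(S,T)$ such that for every $X\subseteq S$, either $|N_{G}(X)\cap T_{1}|+\frac{2}{3}|N_{G}(X)\cap T_{2}|\geq \frac{4}{3}|X|$ or $N_{G}(X)=T$. Then $G$ has an $S$-central path-factor $F$ such that every component $A$ of $F$ with exactly $3$ vertices satisfies $V(A)\cap T_{2}\neq\emptyset$.
   Context: For $U\subseteq V(G)$, $N_{G}(U)=\left(\bigcup_{u\in U}N_{G}(u)\right)\setminus U$, where $N_G(u)$ is the set of neighbours of $u$. A path-factor of a graph is a spanning subgraph whose components are all paths with at least $2$ vertices. For a bipartite graph $G$ with bipartition $(S,T)$, a subgraph $F$ of $G$ is $S$-central if $S\subseteq V(F)$ and $|V(A)\cap T|\geq |V(A)\cap S|$ for every connected component $A$ of $F$. *)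

theory Defs
  imports Complex_Main "Graph_Theory.Digraph_Component" "Graph_Theory.Vertex_Walk"
begin

text \<open>
  A finite simple undirected graph is a \<^locale>\<open>pair_graph\<close>: a finite, loop-free, symmetric
  digraph whose arcs are pairs, so that the edge \<open>uv\<close> is the pair of arcs \<open>(u, v)\<close>, \<open>(v, u)\<close>.
\<close>

definition nbhd :: "'a pair_pre_digraph \<Rightarrow> 'a \<Rightarrow> 'a set" where
  "nbhd G u = {v. u \<rightarrow>\<^bsub>G\<^esub> v}"

definition set_nbhd :: "'a pair_pre_digraph \<Rightarrow> 'a set \<Rightarrow> 'a set" where
  "set_nbhd G U = (\<Union>u\<in>U. nbhd G u) - U"

definition bipartite_graph :: "'a pair_pre_digraph \<Rightarrow> 'a set \<Rightarrow> 'a set \<Rightarrow> bool" where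
  "bipartite_graph G S T \<longleftrightarrow>
     pair_graph G \<and> pverts G = S \<union> T \<and> S \<inter> T = {} \<and> parcs G \<subseteq> S \<times> T \<union> T \<times> S"

text \<open>
  \<^const>\<open>subgraph\<close> alone would also admit subdigraphs containing only one of the two arcs of an
  edge; requiring \<^locale>\<open>pair_graph\<close> makes \<open>F\<close> a subgraph in the undirected sense.
\<close>

definition simple_subgraph :: "'a pair_pre_digraph \<Rightarrow> 'a pair_pre_digraph \<Rightarrow> bool" where
  "simple_subgraph F G \<longleftrightarrow> pair_graph F \<and> subgraph F G"

text \<open>
  As the graphs considered are symmetric, their strongly connected components are their
  connected components.
\<close>

abbreviation components :: "'a pair_pre_digraph \<Rightarrow> ('a, 'a \<times> 'a) pre_digraph set" where
  "components F \<equiv> pre_digraph.sccs (with_proj F)"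

text \<open>
  The whole graph \<open>A\<close> is a path: its vertices are those of a (nonempty, repetition-free) vertex
  sequence, and its only edges are the ones joining consecutive vertices.
\<close>

definition is_path_graph :: "('a, 'b) pre_digraph \<Rightarrow> bool" where
  "is_path_graph A \<longleftrightarrow>
     (\<exists>p. vpath p A \<and> verts A = set p \<and>
          arcs_ends A = set (vwalk_arcs p) \<union> (set (vwalk_arcs p))\<inverse>)"

definition path_factor :: "'a pair_pre_digraph \<Rightarrow> 'a pair_pre_digraph \<Rightarrow> bool" where
  "path_factor F G \<longleftrightarrow>
     simple_subgraph F G \<and> spanning F G \<and>
     (\<forall>A\<in>components F. is_path_graph A \<and> card (verts A) \<ge> 2)"

definition central ::
  "'a pair_pre_digraph \<Rightarrow> 'a set \<Rightarrow> 'a set \<Rightarrow> 'a pair_pre_digraph \<Rightarrow> bool" where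
  "central G S T F \<longleftrightarrow>
     simple_subgraph F G \<and> S \<subseteq> pverts F \<and>
     (\<forall>A\<in>components F. card (verts A \<inter> T) \<ge> card (verts A \<inter> S))"

end

theory Submission
  imports Defs
begin

text \<open>
  Give every vertex of \<open>T\<^sub>1\<close> a supply of 3, every vertex of \<open>T\<^sub>2\<close> a supply of 2 and every vertex of \<open>S\<close>
  a demand of 4; the hypothesis is a weighted Hall condition, up to the sets with \<open>N(X) = T\<close>. Raising
  some supplies of 2 to 3, and then lowering some demands to 3, makes total supply and demand agree up to one unit, and
  then the Hall condition holds for all \<open>X\<close>. So there is an integral flow meeting all demands, and
  it can be chosen with acyclic support.

  On a forest one builds the paths greedily from a root: match the root \<open>s\<close> with the neighbour that
  sends it most, delete both, and recurse. The deleted piece leaves in each remaining component one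
  vertex whose flow is deficient by a small amount. The numbers 3, 2 and 4 are such that a deficient
  \<open>s\<close> always ends up on a path with two vertices, so that a surplus vertex of \<open>T\<close> can be absorbed
  by gluing such paths to it, giving a path \<open>TSTST\<close>, or a path \<open>TST\<close> through \<open>T\<^sub>2\<close>. All other paths
  of the factor are single edges.
\<close>

section \<open>Flows with acyclic support\<close>

definition conn :: "('a \<times> 'a) set \<Rightarrow> ('a \<times> 'a) set" where
  "conn K = (K \<union> K\<inverse>)\<^sup>*"

text \<open>Every edge is a bridge. Only the arc itself is removed, so a loop or an antiparallel
  pair counts as a cycle too; on supports inside \<open>S \<times> T\<close> with disjoint sides
  this is the usual notion of a forest.\<close>

definition cycle_free :: "('a \<times> 'a) set \<Rightarrow> bool" where
  "cycle_free K \<longleftrightarrow> (\<forall>(a, b)\<in>K. (a, b) \<notin> conn (K - {(a, b)}))"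

lemma conn_sym: "(a, b) \<in> conn K \<Longrightarrow> (b, a) \<in> conn K"
  unfolding conn_def by (metis converse_Un converse_converse rtrancl_converseI sup_commute)

lemma conn_trans: "(a, b) \<in> conn K \<Longrightarrow> (b, c) \<in> conn K \<Longrightarrow> (a, c) \<in> conn K"
  unfolding conn_def by (rule rtrancl_trans)

lemma conn_mono: "K \<subseteq> L \<Longrightarrow> (a, b) \<in> conn K \<Longrightarrow> (a, b) \<in> conn L"
  unfolding conn_def using rtrancl_mono[of "K \<union> K\<inverse>" "L \<union> L\<inverse>"] by blast

lemma conn_edge: "(a, b) \<in> K \<Longrightarrow> (a, b) \<in> conn K"
  unfolding conn_def by blast

text \<open>A walk that crosses \<open>st\<close> more than once returns to an endpoint visited
  before and can be shortened, so a single crossing in one of the two directions suffices.\<close>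

lemma conn_insert:
  assumes "(a, b) \<in> conn (insert (s, t) K)"
  shows "(a, b) \<in> conn K \<or> (a, s) \<in> conn K \<and> (t, b) \<in> conn K \<or> (a, t) \<in> conn K \<and> (s, b) \<in> conn K"
  using assms unfolding conn_def[of "insert _ _"]
proof (induction rule: rtrancl_induct)
  case base
  then show ?case by (simp add: conn_def)
next
  case (step y z)
  have refl: "(c, c) \<in> conn K" for c by (simp add: conn_def)
  consider "(y, z) \<in> conn K" | "y = s" "z = t" | "y = t" "z = s"
    using step.hyps(2) conn_edge[of y z K] conn_sym[of z y K] conn_edge[of z y K] by auto
  then show ?case
  proof cases
    case 1
    then show ?thesis using step.IH by (meson conn_trans)
  next
    case 2
    then show ?thesis using step.IH refl by (meson conn_sym conn_trans)
  next
    case 3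
    then show ?thesis using step.IH refl by (meson conn_sym conn_trans)
  qed
qed

text \<open>If an old edge \<open>ab\<close> lay on a cycle through \<open>st\<close>, the rest of
  that cycle, including \<open>ab\<close>, would already join \<open>s\<close> and \<open>t\<close>
  in \<open>K\<close>.\<close>

lemma cycle_free_insert:
  assumes "cycle_free K" "(s, t) \<notin> conn K"
  shows "cycle_free (insert (s, t) K)"
  unfolding cycle_free_def
proof clarify
  fix a b assume ab: "(a, b) \<in> insert (s, t) K" "(a, b) \<in> conn (insert (s, t) K - {(a, b)})"
  have stK: "(s, t) \<notin> K" using assms(2) conn_edge by metis
  show False
  proof (cases "(a, b) = (s, t)")
    case True
    then show False using ab assms(2) stK by simp
  next
    case False
    let ?K = "K - {(a, b)}"
    have K: "(a, b) \<in> K" using ab False by auto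
    then have no: "(a, b) \<notin> conn ?K" using assms(1) by (auto simp: cycle_free_def)
    have "insert (s, t) K - {(a, b)} = insert (s, t) ?K" using False by auto
    then consider "(a, s) \<in> conn ?K" "(t, b) \<in> conn ?K" | "(a, t) \<in> conn ?K" "(s, b) \<in> conn ?K"
      using ab(2) conn_insert[of a b s t ?K] no by auto
    then have "(s, t) \<in> conn K"
    proof cases
      case 1
      then show ?thesis
        using conn_mono[of ?K K] conn_edge[OF K] by (meson Diff_subset conn_sym conn_trans)
    next
      case 2
      then show ?thesis
        using conn_mono[of ?K K] conn_edge[OF K] by (meson Diff_subset conn_sym conn_trans)
    qed
    then show False using assms(2) by simp
  qed
qed

text \<open>No edge of \<open>L\<close> touches \<open>A\<close>, so a walk starting in
  \<open>A\<close> stays there and uses edges of \<open>K\<close> only.\<close>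

lemma conn_Un_separated:
  assumes "(a, b) \<in> conn (K \<union> L)" "K \<subseteq> A \<times> A" "L \<subseteq> B \<times> B" "A \<inter> B = {}" "a \<in> A"
  shows "b \<in> A \<and> (a, b) \<in> conn K"
  using assms(1) unfolding conn_def
proof (induction rule: rtrancl_induct)
  case base
  then show ?case using assms(5) by simp
next
  case (step y z)
  have "(y, z) \<in> K \<union> K\<inverse>" using step assms by blast
  then show ?case using step.IH assms(2) by (auto intro: rtrancl_into_rtrancl)
qed

lemma cycle_free_Un:
  assumes "cycle_free K" "cycle_free L" "K \<subseteq> A \<times> A" "L \<subseteq> B \<times> B" "A \<inter> B = {}"
  shows "cycle_free (K \<union> L)"
  unfolding cycle_free_def
proof clarify
  fix a b assume ab: "(a, b) \<in> K \<union> L" "(a, b) \<in> conn (K \<union> L - {(a, b)})"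
  have e: "K \<union> L - {(a, b)} = (K - {(a, b)}) \<union> (L - {(a, b)})"
    "K \<union> L - {(a, b)} = (L - {(a, b)}) \<union> (K - {(a, b)})" by auto
  have sub: "K - {(a, b)} \<subseteq> A \<times> A" "L - {(a, b)} \<subseteq> B \<times> B" "B \<inter> A = {}" using assms by auto
  show False
  proof (cases "(a, b) \<in> K")
    case True
    then have "a \<in> A" using assms by auto
    then have "(a, b) \<in> conn (K - {(a, b)})"
      using conn_Un_separated[OF ab(2)[unfolded e(1)] sub(1,2) assms(5)] by simp
    then show False using True assms(1) by (auto simp: cycle_free_def)
  next
    case False
    then have L: "(a, b) \<in> L" using ab by simp
    then have "a \<in> B" using assms by auto
    then have "(a, b) \<in> conn (L - {(a, b)})"
      using conn_Un_separated[OF ab(2)[unfolded e(2)] sub(2,1,3)] by simp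
    then show False using L assms(2) by (auto simp: cycle_free_def)
  qed
qed

section \<open>Integral flows from a weighted Hall condition\<close>

definition forest_flow ::
  "('a \<times> 'a) set \<Rightarrow> 'a set \<Rightarrow> 'a set \<Rightarrow> ('a \<Rightarrow> nat) \<Rightarrow> ('a \<Rightarrow> nat) \<Rightarrow> ('a \<Rightarrow> 'a \<Rightarrow> nat) \<Rightarrow> bool" where
  "forest_flow E S T w d f \<longleftrightarrow>
     {(s, t). 0 < f s t} \<subseteq> E \<inter> S \<times> T \<and>
     (\<forall>s\<in>S. (\<Sum>t\<in>T. f s t) = d s) \<and> (\<forall>t\<in>T. (\<Sum>s\<in>S. f s t) \<le> w t) \<and>
     cycle_free {(s, t). 0 < f s t}"

lemma forest_flow_add_edge:
  assumes "forest_flow E S T (w(t := w t - m)) (d(s := d s - m)) f"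
    and "finite S" "finite T" "s \<in> S" "t \<in> T" "(s, t) \<in> E" "m \<le> w t" "m \<le> d s" "s \<noteq> t"
    and nc: "(s, t) \<notin> conn {(s, t). 0 < f s t}"
  shows "forest_flow E S T w d (\<lambda>a b. f a b + (if a = s \<and> b = t then m else 0))"
proof -
  let ?g = "\<lambda>a b. f a b + (if a = s \<and> b = t then m else 0)"
  let ?K = "{(s, t). 0 < f s t}"
  have K: "?K \<subseteq> E \<inter> S \<times> T" "cycle_free ?K"
    and d: "\<And>a. a \<in> S \<Longrightarrow> (\<Sum>b\<in>T. f a b) = (d(s := d s - m)) a"
    and w: "\<And>b. b \<in> T \<Longrightarrow> (\<Sum>a\<in>S. f a b) \<le> (w(t := w t - m)) b"
    using assms(1) unfolding forest_flow_def by auto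
  have supp: "{(s, t). 0 < ?g s t} = (if m = 0 then ?K else insert (s, t) ?K)" by auto
  have "(\<Sum>b\<in>T. ?g a b) = d a" if "a \<in> S" for a
  proof -
    have "(\<Sum>b\<in>T. ?g a b) = (\<Sum>b\<in>T. f a b) + (if a = s then m else 0)"
      using assms(3,5) by (cases "a = s") (simp_all add: sum.distrib)
    then show ?thesis using d[OF that] assms(8) by simp
  qed
  moreover have "(\<Sum>a\<in>S. ?g a b) \<le> w b" if "b \<in> T" for b
  proof -
    have "(\<Sum>a\<in>S. ?g a b) = (\<Sum>a\<in>S. f a b) + (if b = t then m else 0)"
      using assms(2,4) by (cases "b = t") (simp_all add: sum.distrib)
    then show ?thesis using w[OF that] assms(7) by (cases "b = t") auto
  qed
  moreover have "{(s, t). 0 < ?g s t} \<subseteq> E \<inter> S \<times> T"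
    unfolding supp using K(1) assms(4-6) by auto
  moreover have "cycle_free {(s, t). 0 < ?g s t}"
    unfolding supp using K(2) cycle_free_insert[OF K(2) nc] by auto
  ultimately show ?thesis unfolding forest_flow_def by blast
qed

lemma conn_outside:
  assumes "K \<subseteq> A \<times> A" "a \<in> A" "b \<notin> A" shows "(a, b) \<notin> conn K" "(b, a) \<notin> conn K"
proof -
  show "(a, b) \<notin> conn K"
    using conn_Un_separated[of a b K "{}" A "{}"] assms by auto
  then show "(b, a) \<notin> conn K" using conn_sym by metis
qed

text \<open>
  Push the largest amount along an edge \<open>st\<close> that preserves the Hall condition. Then \<open>s\<close> or \<open>t\<close> is
  exhausted, or some tight set splits the instance into two independent ones, between which \<open>st\<close> is
  the only edge carrying flow. In all cases \<open>st\<close> closes no cycle.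
\<close>

lemma weighted_hall_forest:
  fixes w d :: "'a \<Rightarrow> nat"
  assumes "finite S" "finite T" "S \<inter> T = {}"
    and "\<And>X. X \<subseteq> S \<Longrightarrow> sum d X \<le> sum w (T \<inter> E `` X)"
  shows "\<exists>f. forest_flow E S T w d f"
  using assms
proof (induction "card S + card T" arbitrary: S T w d rule: less_induct)
  case less
  note fin = less.prems(1,2) and disj = less.prems(3) and hall = less.prems(4)
  show ?case
  proof (cases "\<exists>s\<in>S. \<exists>t\<in>T. (s, t) \<in> E")
    case False
    have "d s = 0" if "s \<in> S" for s
    proof -
      have "T \<inter> E `` {s} = {}" using that False by auto
      then show ?thesis using hall[of "{s}"] that by simp
    qed
    then have "forest_flow E S T w d (\<lambda>_ _. 0)"
      by (auto simp: forest_flow_def cycle_free_def)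
    then show ?thesis by blast
  next
    case True
    then obtain s t where st: "s \<in> S" "t \<in> T" "(s, t) \<in> E" by blast
    then have neq: "s \<noteq> t" using disj by auto
    define N where "N X = T \<inter> E `` X" for X
    have finN: "finite (N X)" for X using fin by (simp add: N_def)
    \<comment> \<open>Taking \<open>m\<close> from both \<open>w t\<close> and \<open>d s\<close>
      can only hurt a set with \<open>t\<close> but not \<open>s\<close> on its sides: if
      \<open>s \<in> X\<close>, then \<open>t \<in> N X\<close> and both sums drop by
      \<open>m\<close>. So the slacks of the sets in \<open>C\<close>, together with
      \<open>w t\<close> and \<open>d s\<close>, bound \<open>m\<close>.\<close>
    define C where "C = {X. X \<subseteq> S - {s} \<and> t \<in> N X}"
    define M where "M = {w t, d s} \<union> (\<lambda>X. sum w (N X) - sum d X) ` C"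
    have "finite M" unfolding M_def C_def using fin by auto
    define m where "m = Min M"
    have m_le: "m \<le> a" if "a \<in> M" for a unfolding m_def using \<open>finite M\<close> that by simp
    have "m \<in> M" unfolding m_def by (rule Min_in) (use \<open>finite M\<close> in \<open>auto simp: M_def\<close>)
    have mw: "m \<le> w t" and md: "m \<le> d s" using m_le by (auto simp: M_def)
    define w' where "w' = w(t := w t - m)"
    define d' where "d' = d(s := d s - m)"
    have w'sum: "sum w' Y + (if t \<in> Y then m else 0) = sum w Y" if "finite Y" for Y
      using that mw by (auto simp: w'_def sum.remove[of Y t] intro!: sum.cong)
    have d'sum: "sum d' Y + (if s \<in> Y then m else 0) = sum d Y" if "finite Y" for Y
      using that md by (auto simp: d'_def sum.remove[of Y s] intro!: sum.cong)
    have hall': "sum d' X \<le> sum w' (N X)" if "X \<subseteq> S" for X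
    proof -
      have fX: "finite X" using that fin finite_subset by blast
      have h: "sum d X \<le> sum w (N X)" using hall[OF that] by (simp add: N_def)
      show ?thesis
      proof (cases "s \<in> X")
        case True
        then have "t \<in> N X" using st by (auto simp: N_def)
        then show ?thesis using True h w'sum[OF finN[of X]] d'sum[OF fX] by simp
      next
        case False
        show ?thesis
        proof (cases "t \<in> N X")
          case True
          then have "X \<in> C" using False that by (auto simp: C_def)
          then have "m \<le> sum w (N X) - sum d X" using m_le by (auto simp: M_def)
          then show ?thesis using h True False w'sum[OF finN[of X]] d'sum[OF fX] by simp
        next
          case nt: False
          then show ?thesis using False h w'sum[OF finN[of X]] d'sum[OF fX] by simp
        qed
      qed
    qed
    have lift: "\<exists>f. forest_flow E S T w d f"
      if "forest_flow E S T w' d' f" "(s, t) \<notin> conn {(s, t). 0 < f s t}" for f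
      using forest_flow_add_edge[OF that(1)[unfolded w'_def d'_def] fin st mw md neq that(2)] by blast
    consider "m = w t" | "m = d s" | X where "X \<in> C" "m = sum w (N X) - sum d X"
      using \<open>m \<in> M\<close> by (auto simp: M_def)
    then show ?thesis
    proof cases
      case 1
      let ?T = "T - {t}"
      have "card ?T < card T" using st fin by (meson card_Diff1_less)
      moreover have "sum d' X \<le> sum w' (?T \<inter> E `` X)" if "X \<subseteq> S" for X
      proof -
        have "sum w' (N X) = sum w' (?T \<inter> E `` X)"
          using fin 1 by (intro sum.mono_neutral_right) (auto simp: N_def w'_def)
        then show ?thesis using hall'[OF that] by simp
      qed
      ultimately obtain f where f: "forest_flow E S ?T w' d' f"
        using less.hyps[of S ?T d' w'] fin disj by fastforce
      then have K: "{(s, t). 0 < f s t} \<subseteq> S \<times> ?T" by (auto simp: forest_flow_def)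
      then have z: "f a t = 0" for a by auto
      then have "(\<Sum>b\<in>T. f a b) = (\<Sum>b\<in>?T. f a b)" for a
        using fin st by (simp add: sum.remove)
      then have "forest_flow E S T w' d' f"
        using f K z unfolding forest_flow_def by (intro conjI) auto
      moreover have "(s, t) \<notin> conn {(s, t). 0 < f s t}"
        by (rule conn_outside[of _ "S \<union> ?T"]) (use K st disj in auto)
      ultimately show ?thesis using lift by blast
    next
      case 2
      let ?S = "S - {s}"
      have "card ?S < card S" using st fin by (meson card_Diff1_less)
      moreover have "sum d' X \<le> sum w' (T \<inter> E `` X)" if "X \<subseteq> ?S" for X
        using hall'[of X] that by (auto simp: N_def)
      ultimately obtain f where f: "forest_flow E ?S T w' d' f"
        using less.hyps[of ?S T d' w'] fin disj by fastforce
      then have K: "{(s, t). 0 < f s t} \<subseteq> ?S \<times> T" by (auto simp: forest_flow_def)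
      then have z: "f s b = 0" for b by auto
      then have "(\<Sum>a\<in>S. f a b) = (\<Sum>a\<in>?S. f a b)" for b
        using fin st by (simp add: sum.remove)
      moreover have "d' s = 0" using 2 by (simp add: d'_def)
      ultimately have "forest_flow E S T w' d' f"
        using f K z unfolding forest_flow_def by (intro conjI) auto
      moreover have "(s, t) \<notin> conn {(s, t). 0 < f s t}"
        by (rule conn_outside[of _ "?S \<union> T"]) (use K st disj in auto)
      ultimately show ?thesis using lift by blast
    next
      case 3
      have XS: "X \<subseteq> S" "s \<notin> X" "t \<in> N X" using 3 by (auto simp: C_def)
      have fX: "finite X" using XS fin finite_subset by blast
      have tight: "sum w' (N X) = sum d' X"
        using hall[OF XS(1)] 3(2) XS w'sum[OF finN[of X]] d'sum[OF fX] by (simp add: N_def)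
      let ?S = "S - X" and ?T = "T - N X"
      have NT: "N X \<subseteq> T" by (auto simp: N_def)
      \<comment> \<open>Both halves are smaller instances: the first misses \<open>s\<close>, the
        second misses \<open>t\<close>.\<close>
      have cX: "card X < card S" using XS st fin by (intro psubset_card_mono) auto
      have cN: "card (N X) \<le> card T" using NT fin by (intro card_mono)
      have cS': "card ?S \<le> card S" using fin by (intro card_mono) auto
      have cT': "card ?T < card T" using XS st fin by (intro psubset_card_mono) auto
      have "sum d' Y \<le> sum w' (N X \<inter> E `` Y)" if "Y \<subseteq> X" for Y
      proof -
        have "N X \<inter> E `` Y = N Y" using that by (auto simp: N_def)
        then show ?thesis using hall'[of Y] that XS by simp
      qed
      then obtain f where f: "forest_flow E X (N X) w' d' f"
        using less.hyps[of X "N X" d' w'] cX cN fX finN disj XS NT by (fastforce simp: add_less_le_mono)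
      \<comment> \<open>Since \<open>X\<close> is tight, cancelling its contribution from the
        condition for \<open>X \<union> Y\<close> leaves the condition for \<open>Y\<close> in the
        second half.\<close>
      have "sum d' Y \<le> sum w' (?T \<inter> E `` Y)" if "Y \<subseteq> ?S" for Y
      proof -
        have fY: "finite Y" using that fin by (meson finite_Diff finite_subset)
        have "N (X \<union> Y) = N X \<union> (?T \<inter> E `` Y)" by (auto simp: N_def)
        then have "sum w' (N (X \<union> Y)) = sum w' (N X) + sum w' (?T \<inter> E `` Y)"
          using fin finN by (simp add: sum.union_disjoint Int_Diff disjoint_iff)
        moreover have "sum d' (X \<union> Y) = sum d' X + sum d' Y"
          using fX fY that by (intro sum.union_disjoint) auto
        moreover have "sum d' (X \<union> Y) \<le> sum w' (N (X \<union> Y))" using hall'[of "X \<union> Y"] that XS by blast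
        ultimately show ?thesis using tight by simp
      qed
      then obtain g where g: "forest_flow E ?S ?T w' d' g"
        using less.hyps[of ?S ?T d' w'] cS' cT' fin disj by (fastforce simp: add_le_less_mono)
      define h where "h a b = f a b + g a b" for a b
      have Kf: "{(s, t). 0 < f s t} \<subseteq> X \<times> N X" and Kg: "{(s, t). 0 < g s t} \<subseteq> ?S \<times> ?T"
        using f g by (auto simp: forest_flow_def)
      have f0: "f a b = 0" if "a \<notin> X \<or> b \<notin> N X" for a b using Kf that by auto
      have g0: "g a b = 0" if "a \<notin> ?S \<or> b \<notin> ?T" for a b using Kg that by auto
      have supp: "{(s, t). 0 < h s t} = {(s, t). 0 < f s t} \<union> {(s, t). 0 < g s t}"
        by (auto simp: h_def)
      have sf: "(\<Sum>b\<in>T. f a b) = (\<Sum>b\<in>N X. f a b)" "(\<Sum>b\<in>T. g a b) = (\<Sum>b\<in>?T. g a b)" for a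
        using fin NT f0 g0 by (auto intro!: sum.mono_neutral_right)
      have sf': "(\<Sum>a\<in>S. f a b) = (\<Sum>a\<in>X. f a b)" "(\<Sum>a\<in>S. g a b) = (\<Sum>a\<in>?S. g a b)" for b
        using fin XS f0 g0 by (auto intro!: sum.mono_neutral_right)
      have "(\<Sum>b\<in>T. h a b) = d' a" if "a \<in> S" for a
        using f g that f0 g0
        by (cases "a \<in> X") (simp_all add: h_def sum.distrib sf forest_flow_def)
      moreover have "(\<Sum>a\<in>S. h a b) \<le> w' b" if "b \<in> T" for b
        using f g that f0 g0
        by (cases "b \<in> N X") (simp_all add: h_def sum.distrib sf' forest_flow_def)
      moreover have "cycle_free {(s, t). 0 < h s t}"
        unfolding supp
        by (rule cycle_free_Un[where A = "X \<union> N X" and B = "?S \<union> ?T"])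
          (use f g Kf Kg disj XS NT in \<open>auto simp: forest_flow_def\<close>)
      moreover have "{(s, t). 0 < h s t} \<subseteq> E \<inter> S \<times> T"
        unfolding supp using f g XS NT by (auto simp: forest_flow_def)
      ultimately have "forest_flow E S T w' d' h" by (simp add: forest_flow_def)
      moreover have "(t, s) \<notin> conn {(s, t). 0 < h s t}"
        using conn_Un_separated[of t s "{(s, t). 0 < f s t}" "{(s, t). 0 < g s t}" "X \<union> N X" "?S \<union> ?T"]
          Kf Kg disj XS NT st unfolding supp by blast
      ultimately show ?thesis using lift conn_sym by metis
    qed
  qed
qed

section \<open>Decomposing a balanced forest into paths\<close>

text \<open>The three shapes of paths in the factor, with arcs of \<open>E\<close> directed from
  \<open>S\<close> to \<open>T\<close>. A path with two vertices is always listed from its vertex in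
  \<open>S\<close>, which is the form that the gluing steps look up.\<close>

inductive central_path :: "('a \<times> 'a) set \<Rightarrow> 'a set \<Rightarrow> 'a list \<Rightarrow> bool" for E T2 where
  P2: "(s, t) \<in> E \<Longrightarrow> central_path E T2 [s, t]"
| P3: "{(s, t), (s, t')} \<subseteq> E \<Longrightarrow> t \<noteq> t' \<Longrightarrow> t \<in> T2 \<or> t' \<in> T2 \<Longrightarrow> central_path E T2 [t, s, t']"
| P5: "{(s, t), (s, t'), (s', t'), (s', t'')} \<subseteq> E \<Longrightarrow> s \<noteq> s' \<Longrightarrow> distinct [t, t', t''] \<Longrightarrow>
    central_path E T2 [t, s, t', s', t'']"

lemma central_path_mono:
  "central_path E T2 p \<Longrightarrow> E \<subseteq> E' \<Longrightarrow> T2 \<subseteq> T2' \<Longrightarrow> central_path E' T2' p"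
  by (erule central_path.cases) (auto intro!: central_path.intros)

text \<open>The flow appears here as a symmetric weight \<open>x\<close> on an undirected forest, so
  that vertices of both sides can be treated alike; \<open>acyc\<close> says that each edge is a
  bridge. The parameter \<open>T2\<close> stands for the vertices whose supply is still 2 after
  balancing.\<close>

locale balanced_forest =
  fixes S T T2 :: "'a set" and cap :: "'a \<Rightarrow> nat" and x :: "'a \<Rightarrow> 'a \<Rightarrow> nat"
  assumes fin: "finite S" "finite T"
    and disj: "S \<inter> T = {}"
    and cap_S: "s \<in> S \<Longrightarrow> cap s = 3 \<or> cap s = 4"
    and cap_T: "t \<in> T \<Longrightarrow> cap t = (if t \<in> T2 then 2 else 3)"
    and x_sym: "x u v = x v u"
    and x_bip: "0 < x u v \<Longrightarrow> u \<in> S \<and> v \<in> T \<or> u \<in> T \<and> v \<in> S"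
    and x_cap: "v \<in> S \<union> T \<Longrightarrow> (\<Sum>u\<in>S \<union> T. x v u) \<le> cap v"
    and acyc: "0 < x a b \<Longrightarrow> (a, b) \<notin> {(u, v). 0 < x u v \<and> {u, v} \<noteq> {a, b}}\<^sup>*"
begin

section \<open>Deleting a connected piece of the forest\<close>

definition link :: "'a set \<Rightarrow> ('a \<times> 'a) set" where
  "link V = {(u, v). u \<in> V \<and> v \<in> V \<and> 0 < x u v}"

text \<open>For \<open>V \<subseteq> S \<union> T\<close> and \<open>v \<in> S \<union> T\<close>
  the subtraction is not truncated, because the weights at \<open>v\<close> never exceed its
  capacity.\<close>

definition defect :: "'a set \<Rightarrow> 'a \<Rightarrow> nat" where
  "defect V v = cap v - (\<Sum>u\<in>V. x v u)"

text \<open>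
  The invariant of the recursion on the set \<open>V\<close> of vertices not yet covered: a component of the forest
  on \<open>V\<close> has at most one defective vertex, namely the one that lost its parent.
\<close>

definition admissible :: "'a set \<Rightarrow> bool" where
  "admissible V \<longleftrightarrow> V \<subseteq> S \<union> T \<and>
     (\<forall>s\<in>V \<inter> S. defect V s \<le> 2) \<and> (\<forall>t\<in>V \<inter> T. defect V t \<le> 1) \<and>
     (\<forall>u v. (u, v) \<in> (link V)\<^sup>* \<longrightarrow> u \<in> V \<longrightarrow> v \<in> V \<longrightarrow> 0 < defect V u \<longrightarrow> 0 < defect V v \<longrightarrow> u = v)"

lemma link_mono: "U \<subseteq> V \<Longrightarrow> (u, v) \<in> (link U)\<^sup>* \<Longrightarrow> (u, v) \<in> (link V)\<^sup>*"
  by (rule rtrancl_mono[THEN subsetD]) (auto simp: link_def)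

lemma link_sym: "(u, v) \<in> (link V)\<^sup>* \<Longrightarrow> (v, u) \<in> (link V)\<^sup>*"
  by (rule symD[OF sym_rtrancl]) (auto simp: link_def sym_def x_sym)

lemma link_step: "u \<in> V \<Longrightarrow> v \<in> V \<Longrightarrow> 0 < x u v \<Longrightarrow> (u, v) \<in> (link V)\<^sup>*"
  by (auto simp: link_def)

lemma sum_le_cap: "V \<subseteq> S \<union> T \<Longrightarrow> v \<in> S \<union> T \<Longrightarrow> (\<Sum>u\<in>V. x v u) \<le> cap v"
  by (rule order_trans[OF sum_mono2 x_cap]) (use fin in auto)

lemma finite_sub: "V \<subseteq> S \<union> T \<Longrightarrow> finite V"
  using fin by (meson finite_UnI finite_subset)

lemma sum_diff_split:
  "V \<subseteq> S \<union> T \<Longrightarrow> R \<subseteq> V \<Longrightarrow> (\<Sum>u\<in>V. x v u) = (\<Sum>u\<in>R. x v u) + (\<Sum>u\<in>V - R. x v u)"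
  using finite_sub by (metis add.commute sum.subset_diff)

text \<open>Two different edges from a connected set \<open>R\<close> into one component outside
  \<open>R\<close> would close a cycle.\<close>

lemma acyc_link:
  assumes "u \<in> R" "u' \<in> R" "v \<notin> R" "v' \<notin> R" "V \<inter> R = {}"
    and "0 < x u v" "0 < x u' v'" "(v, v') \<in> (link V)\<^sup>*" "(u', u) \<in> (link R)\<^sup>*"
  shows "u = u' \<and> v = v'"
proof (rule ccontr)
  assume ne: "\<not> (u = u' \<and> v = v')"
  let ?L = "{(a, b). 0 < x a b \<and> {a, b} \<noteq> {u, v}}"
  have "(v, v') \<in> ?L\<^sup>*"
    by (rule subsetD[OF rtrancl_mono assms(8)]) (use assms(1,5) in \<open>auto simp: link_def doubleton_eq_iff\<close>)
  moreover have "(v', u') \<in> ?L\<^sup>*"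
    using ne assms(1-4,7) x_sym[of u' v'] by (intro r_into_rtrancl) (auto simp: doubleton_eq_iff)
  moreover have "(u', u) \<in> ?L\<^sup>*"
    by (rule subsetD[OF rtrancl_mono assms(9)]) (use assms(3) in \<open>auto simp: link_def doubleton_eq_iff\<close>)
  ultimately have "(v, u) \<in> ?L\<^sup>*" by (meson rtrancl_trans)
  then show False using acyc[of v u] assms(6) x_sym[of u v] by (simp add: insert_commute)
qed

text \<open>By \<open>acyc_link\<close>, each remaining component is joined to \<open>R\<close> by
  at most one edge. Its end outside \<open>R\<close> had no defect by \<open>root\<close>, and its
  new defect is exactly the weight of that edge, which \<open>bdS\<close> and \<open>bdT\<close>
  bound. Vertices not adjacent to \<open>R\<close> keep their defect.\<close>

lemma remove_connected:
  assumes adm: "admissible V" and R: "R \<subseteq> V" "r \<in> R"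
    and conR: "\<And>u. u \<in> R \<Longrightarrow> (r, u) \<in> (link R)\<^sup>*"
    and root: "\<And>v. v \<in> V - R \<Longrightarrow> (r, v) \<in> (link V)\<^sup>* \<Longrightarrow> defect V v = 0"
    and bdS: "\<And>u v. u \<in> R \<Longrightarrow> v \<in> V - R \<Longrightarrow> v \<in> S \<Longrightarrow> x u v \<le> 2"
    and bdT: "\<And>u v. u \<in> R \<Longrightarrow> v \<in> V - R \<Longrightarrow> v \<in> T \<Longrightarrow> x u v \<le> 1"
  shows "admissible (V - R)"
    and "\<And>u v. u \<in> R \<Longrightarrow> v \<in> V - R \<Longrightarrow> 0 < x u v \<Longrightarrow> 0 < defect (V - R) v \<and> defect V v = 0"
    and "\<And>v. defect V v \<le> defect (V - R) v"
proof -
  let ?W = "V - R"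
  have VST: "V \<subseteq> S \<union> T" using adm by (simp add: admissible_def)
  have conn: "(u, u') \<in> (link R)\<^sup>*" if "u \<in> R" "u' \<in> R" for u u'
    using conR link_sym that by (meson rtrancl_trans)
  have uniq: "u = u'" if "u \<in> R" "u' \<in> R" "v \<in> ?W" "0 < x u v" "0 < x u' v" for u u' v
    using acyc_link[of u R u' v v "{}"] that conn[OF that(2,1)] by simp
  have reach: "(r, v) \<in> (link V)\<^sup>*" if "u \<in> R" "v \<in> ?W" "0 < x u v" for u v
    using link_mono[OF R(1) conR[OF that(1)]] link_step[of u V v] that R
    by (meson DiffD1 rtrancl_trans subsetD)
  have far: "defect ?W v = defect V v" if "v \<in> ?W" "\<forall>u\<in>R. x u v = 0" for v
  proof -
    have "(\<Sum>u\<in>R. x v u) = 0" using that x_sym by (simp add: sum.neutral)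
    then show ?thesis using sum_diff_split[OF VST R(1), of v] by (simp add: defect_def)
  qed
  have near: "defect ?W v = x u v" "defect V v = 0" if "u \<in> R" "v \<in> ?W" "0 < x u v" for u v
  proof -
    show 0: "defect V v = 0" using root reach that by blast
    have "(\<Sum>w\<in>R. x v w) = (\<Sum>w\<in>{u}. x v w)"
    proof (rule sum.mono_neutral_right)
      show "\<forall>w\<in>R - {u}. x v w = 0"
        using that uniq[of u _ v] x_sym[of v] by (metis DiffE gr0I insertCI)
    qed (use that VST R finite_sub in \<open>auto intro: finite_subset\<close>)
    then show "defect ?W v = x u v"
      using sum_diff_split[OF VST R(1), of v] 0 sum_le_cap[OF VST, of v] that VST x_sym[of u v]
      by (auto simp: defect_def)
  qed
  show "\<And>u v. u \<in> R \<Longrightarrow> v \<in> V - R \<Longrightarrow> 0 < x u v \<Longrightarrow> 0 < defect (V - R) v \<and> defect V v = 0"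
    using near by simp
  show "\<And>v. defect V v \<le> defect (V - R) v"
    using sum_diff_split[OF VST R(1)] by (simp add: defect_def)
  have dS: "defect ?W s \<le> 2" if "s \<in> ?W \<inter> S" for s
  proof (cases "\<forall>u\<in>R. x u s = 0")
    case True
    then show ?thesis using far[of s] adm that by (auto simp: admissible_def)
  next
    case False
    then obtain u where "u \<in> R" "0 < x u s" by auto
    then show ?thesis using near(1) bdS that by simp
  qed
  have dT: "defect ?W t \<le> 1" if "t \<in> ?W \<inter> T" for t
  proof (cases "\<forall>u\<in>R. x u t = 0")
    case True
    then show ?thesis using far[of t] adm that by (auto simp: admissible_def)
  next
    case False
    then obtain u where "u \<in> R" "0 < x u t" by auto
    then show ?thesis using near(1) bdT that by simp
  qed
  have "v = v'"
    if c: "(v, v') \<in> (link ?W)\<^sup>*" and v: "v \<in> ?W" "v' \<in> ?W"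
      and pos: "0 < defect ?W v" "0 < defect ?W v'" for v v'
  proof -
    have cV: "(v, v') \<in> (link V)\<^sup>*" using link_mono[OF _ c] by blast
    \<comment> \<open>Either both defects are old, or both are new and \<open>acyc_link\<close>
      applies, or one is old in the component of \<open>r\<close>, against
      \<open>root\<close>.\<close>
    consider "\<forall>u\<in>R. x u v = 0" "\<forall>u\<in>R. x u v' = 0"
      | u u' where "u \<in> R" "0 < x u v" "u' \<in> R" "0 < x u' v'"
      | u where "u \<in> R" "0 < x u v" "\<forall>u\<in>R. x u v' = 0"
      | u where "u \<in> R" "0 < x u v'" "\<forall>u\<in>R. x u v = 0"
      by (metis neq0_conv)
    then show ?thesis
    proof cases
      case 1
      then show ?thesis using far v pos cV adm by (simp add: admissible_def)
    next
      case 2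
      then show ?thesis using acyc_link[of u R u' v v' ?W] v c conn[of u' u] by blast
    next
      case 3
      then have "(r, v') \<in> (link V)\<^sup>*" using reach v cV by (meson rtrancl_trans)
      then show ?thesis using root[OF v(2)] far[OF v(2)] 3 pos by simp
    next
      case 4
      then have "(r, v) \<in> (link V)\<^sup>*" using reach v link_sym[OF cV] by (meson rtrancl_trans)
      then show ?thesis using root[OF v(1)] far[OF v(1)] 4 pos by simp
    qed
  qed
  then show "admissible ?W" using dS dT VST unfolding admissible_def by auto
qed

section \<open>Path systems and gluing\<close>

abbreviation unit_path :: "'a list \<Rightarrow> bool" where
  "unit_path \<equiv> central_path {(s, t). s \<in> S \<and> 0 < x s t} T2"

text \<open>The last clause is what allows the parent of \<open>s\<close> to be glued to the path of \<open>s\<close>.\<close>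

definition solution :: "'a set \<Rightarrow> 'a list set \<Rightarrow> bool" where
  "solution V P \<longleftrightarrow> (\<forall>p\<in>P. unit_path p) \<and> (\<Union>p\<in>P. set p) = V \<and>
     (\<forall>p\<in>P. \<forall>q\<in>P. p \<noteq> q \<longrightarrow> set p \<inter> set q = {}) \<and>
     (\<forall>s\<in>V \<inter> S. 0 < defect V s \<longrightarrow> (\<exists>t. [s, t] \<in> P))"

text \<open>The paths in \<open>Q\<close> are merged with the deleted vertices \<open>R\<close> into
  the single path \<open>p\<close>. By \<open>Q0\<close> and \<open>R0\<close>, no defective vertex
  of \<open>S\<close> loses its two-vertex path in this way.\<close>

lemma solution_extend:
  assumes sol: "solution (V - R) P" and R: "R \<subseteq> V" and Q: "Q \<subseteq> P"
    and p: "unit_path p" "set p = R \<union> (\<Union>q\<in>Q. set q)"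
    and mono: "\<And>v. defect V v \<le> defect (V - R) v"
    and Q0: "\<And>s t. [s, t] \<in> Q \<Longrightarrow> defect V s = 0"
    and R0: "\<And>s. s \<in> R \<inter> S \<Longrightarrow> 0 < defect V s \<Longrightarrow> \<exists>t. p = [s, t]"
  shows "solution V (insert p (P - Q))"
proof -
  have P: "\<forall>p\<in>P. unit_path p" "(\<Union>p\<in>P. set p) = V - R"
    "\<forall>p\<in>P. \<forall>q\<in>P. p \<noteq> q \<longrightarrow> set p \<inter> set q = {}"
    "\<forall>s\<in>(V - R) \<inter> S. 0 < defect (V - R) s \<longrightarrow> (\<exists>t. [s, t] \<in> P)"
    using sol by (auto simp: solution_def)
  have "(\<Union>q\<in>insert p (P - Q). set q) = R \<union> (\<Union>q\<in>P. set q)"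
    using Q unfolding UN_insert p(2) by blast
  then have "(\<Union>q\<in>insert p (P - Q). set q) = V" unfolding P(2) using R by blast
  moreover have "set p \<inter> set q = {}" if "q \<in> P - Q" for q
  proof -
    have "set q \<subseteq> V - R" using that P(2) by blast
    moreover have "set q' \<inter> set q = {}" if "q' \<in> Q" for q'
      using \<open>q \<in> P - Q\<close> that P(3) Q by (metis DiffE subsetD)
    ultimately show ?thesis unfolding p(2) by blast
  qed
  moreover have "\<exists>t. [s, t] \<in> insert p (P - Q)" if s: "s \<in> V \<inter> S" "0 < defect V s" for s
  proof (cases "s \<in> R")
    case True
    then show ?thesis using R0 s by auto
  next
    case False
    have "0 < defect (V - R) s" using s(2) mono[of s] by linarith
    then obtain t where "[s, t] \<in> P" using P(4) s(1) False by blast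
    then show ?thesis using Q0[of s t] s by auto
  qed
  moreover have "\<forall>q\<in>insert p (P - Q). unit_path q" using P(1) p(1) by blast
  ultimately show ?thesis using P(3) unfolding solution_def
    by (intro conjI) (blast, blast, metis Diff_iff Int_commute insert_iff, blast)
qed

section \<open>Capacity estimates and the recursion\<close>

lemma x_zero:
  shows "u \<in> S \<Longrightarrow> v \<in> S \<Longrightarrow> x u v = 0" and "u \<in> T \<Longrightarrow> v \<in> T \<Longrightarrow> x u v = 0"
  using x_bip[of u v] disj by auto

lemma sum_subset_le: "V \<subseteq> S \<union> T \<Longrightarrow> A \<subseteq> V \<Longrightarrow> (\<Sum>u\<in>A. x v u) \<le> (\<Sum>u\<in>V. x v u)"
  using finite_sub by (intro sum_mono2) auto

lemma obtain_further:
  assumes "V \<subseteq> S \<union> T" "A \<subseteq> V" "(\<Sum>u\<in>A. x v u) < (\<Sum>u\<in>V. x v u)"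
  obtains u where "u \<in> V - A" "0 < x v u"
proof -
  have "(\<Sum>u\<in>V - A. x v u) \<noteq> 0" using sum_diff_split[OF assms(1,2), of v] assms(3) by simp
  then obtain u where "u \<in> V - A" "x v u \<noteq> 0" by (rule sum.not_neutral_contains_not_neutral)
  then show ?thesis using that by blast
qed

lemma sum_V: "admissible V \<Longrightarrow> v \<in> V \<Longrightarrow> (\<Sum>u\<in>V. x v u) = cap v - defect V v"
  using sum_le_cap[of V v] unfolding admissible_def defect_def by (metis diff_diff_cancel subsetD)

lemma sum_V_le: "admissible V \<Longrightarrow> v \<in> V \<Longrightarrow> (\<Sum>u\<in>V. x v u) \<le> cap v"
  using sum_V by simp

lemma x_pair_le: "admissible V \<Longrightarrow> {w, u, v} \<subseteq> V \<Longrightarrow> u \<noteq> v \<Longrightarrow> x w u + x w v \<le> cap w"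
  using sum_subset_le[of V "{u, v}" w] sum_V_le[of V w] by (auto simp: admissible_def)

lemma x_triple_le:
  "admissible V \<Longrightarrow> {w, u, v, z} \<subseteq> V \<Longrightarrow> distinct [u, v, z] \<Longrightarrow> x w u + x w v + x w z \<le> cap w"
  using sum_subset_le[of V "{u, v, z}" w] sum_V_le[of V w] by (auto simp: admissible_def)

text \<open>Deleting \<open>R\<close> makes each neighbour \<open>s \<in> S\<close> of
  \<open>R\<close> defective, so the recursive solution puts it on a two-vertex path. Since
  \<open>s\<close> had no defect before the deletion, that path may be glued to
  \<open>R\<close>.\<close>

lemma peel:
  assumes adm: "admissible V" and R: "R \<subseteq> V" "r \<in> R"
    and IH: "\<And>U. U \<subset> V \<Longrightarrow> admissible U \<Longrightarrow> \<exists>P. solution U P"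
    and conR: "\<And>u. u \<in> R \<Longrightarrow> (r, u) \<in> (link R)\<^sup>*"
    and root: "\<And>v. v \<in> V - R \<Longrightarrow> (r, v) \<in> (link V)\<^sup>* \<Longrightarrow> defect V v = 0"
    and bdS: "\<And>u v. u \<in> R \<Longrightarrow> v \<in> V - R \<Longrightarrow> v \<in> S \<Longrightarrow> x u v \<le> 2"
    and bdT: "\<And>u v. u \<in> R \<Longrightarrow> v \<in> V - R \<Longrightarrow> v \<in> T \<Longrightarrow> x u v \<le> 1"
  obtains P where "solution (V - R) P" and "\<forall>v. defect V v \<le> defect (V - R) v"
    and "\<forall>u\<in>R. \<forall>s\<in>(V - R) \<inter> S. 0 < x u s \<longrightarrow>
      defect V s = 0 \<and> (\<exists>t\<in>V - R. [s, t] \<in> P \<and> 0 < x s t)"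
proof -
  note rem = remove_connected[OF adm R conR root bdS bdT]
  have "V - R \<subset> V" using R by auto
  then obtain P where P: "solution (V - R) P" using IH rem(1) by blast
  have "defect V s = 0 \<and> (\<exists>t\<in>V - R. [s, t] \<in> P \<and> 0 < x s t)"
    if us: "u \<in> R" "s \<in> V - R" "s \<in> S" "0 < x u s" for u s
  proof -
    have d: "0 < defect (V - R) s" "defect V s = 0" using rem(2) us(1,2,4) by blast+
    then obtain t where t: "[s, t] \<in> P" using P us(2,3) unfolding solution_def by blast
    then have "unit_path [s, t]" "set [s, t] \<subseteq> V - R" using P unfolding solution_def by blast+
    then show ?thesis using d(2) t by (auto elim: central_path.cases)
  qed
  then show ?thesis using that P rem(3) by blast
qed

text \<open>The root \<open>s\<close> is matched with \<open>t1\<close>, and the pair is deleted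
  unless \<open>s\<close> sends at least 2 to some other vertex, whose defect would then be too big.
  The hypothesis \<open>large\<close> covers both uses: \<open>t1\<close> is the heaviest neighbour
  of \<open>s\<close>, or \<open>s\<close> sends 2 to it.\<close>

lemma solve_at_S:
  assumes IH: "\<And>U. U \<subset> V \<Longrightarrow> admissible U \<Longrightarrow> \<exists>P. solution U P"
    and adm: "admissible V"
    and s: "s \<in> V" "s \<in> S" and t1: "t1 \<in> V" "t1 \<in> T" "0 < x s t1"
    and root: "\<And>v. v \<in> V \<Longrightarrow> (s, v) \<in> (link V)\<^sup>* \<Longrightarrow> v \<noteq> s \<Longrightarrow> v \<noteq> t1 \<Longrightarrow> defect V v = 0"
    and large: "x s t1 \<le> 1 \<Longrightarrow> \<forall>t\<in>V - {t1}. x s t \<le> 1"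
  shows "\<exists>P. solution V P"
proof -
  have VST: "V \<subseteq> S \<union> T" using adm by (simp add: admissible_def)
  have neq: "s \<noteq> t1" using s t1 disj by auto
  have cap3: "cap t \<le> 3" if "t \<in> T" for t using cap_T[OF that] by auto
  have cap4: "cap s \<le> 4" using cap_S[OF s(2)] by auto
  show ?thesis
  proof (cases "\<forall>t\<in>V - {t1}. x s t \<le> 1")
    case True
    \<comment> \<open>The edge from \<open>s\<close> uses at least 1 of the capacity of
      \<open>t1\<close>, which is at most 3, so any other neighbour of \<open>t1\<close> loses at
      most 2.\<close>
    let ?R = "{s, t1}"
    have c: "(s, u) \<in> (link ?R)\<^sup>*" if "u \<in> ?R" for u
      using that t1 link_step[of s ?R t1] by auto
    have b2: "x u v \<le> 2" if "u \<in> ?R" "v \<in> V - ?R" "v \<in> S" for u v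
    proof (cases "u = s")
      case True
      then show ?thesis using x_zero(1)[of s v] s that by simp
    next
      case False
      then have "u = t1" using that by simp
      then show ?thesis
        using x_pair_le[OF adm, of t1 s v] that s t1 cap3[OF t1(2)] x_sym[of t1 s] by auto
    qed
    have b1: "x u v \<le> 1" if "u \<in> ?R" "v \<in> V - ?R" "v \<in> T" for u v
    proof (cases "u = s")
      case True
      then show ?thesis using \<open>\<forall>t\<in>V - {t1}. x s t \<le> 1\<close> that by simp
    next
      case False
      then have "u = t1" using that by simp
      then show ?thesis using x_zero(2)[of t1 v] t1 that by simp
    qed
    have RV: "?R \<subseteq> V" using s t1 by simp
    have root': "defect V v = 0" if "v \<in> V - ?R" "(s, v) \<in> (link V)\<^sup>*" for v
      using root that by simp
    obtain P where P: "solution (V - ?R) P" "\<forall>v. defect V v \<le> defect (V - ?R) v"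
      "\<forall>u\<in>?R. \<forall>s\<in>(V - ?R) \<inter> S. 0 < x u s \<longrightarrow>
         defect V s = 0 \<and> (\<exists>t\<in>V - ?R. [s, t] \<in> P \<and> 0 < x s t)"
      by (rule peel[OF adm RV insertI1 IH c root' b2 b1])
    have "solution V (insert [s, t1] (P - {}))"
      by (rule solution_extend[OF P(1) RV _ _ _ P(2)[rule_format]]) (use s t1 disj in \<open>auto intro: central_path.P2\<close>)
    then show ?thesis by blast
  next
    case False
    then obtain t2 where t2: "t2 \<in> V" "t2 \<noteq> t1" "2 \<le> x s t2"
      by (metis DiffE insertI1 not_less_eq_eq numeral_2_eq_2 One_nat_def)
    \<comment> \<open>Now \<open>s\<close> sends exactly 2 to each of \<open>t1\<close> and
      \<open>t2\<close>, which exhausts its capacity 4. Hence it has no defect and no further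
      neighbour in \<open>V\<close>, and may be the middle of a longer path.\<close>
    have x1: "2 \<le> x s t1" using large False by fastforce
    have t2T: "t2 \<in> T" using x_bip[of s t2] t2 s disj by auto
    have s2: "s \<noteq> t2" using s t2T disj by auto
    let ?R = "{s, t1, t2}"
    have RV: "?R \<subseteq> V" using s t1 t2 by simp
    have c: "(s, u) \<in> (link ?R)\<^sup>*" if "u \<in> ?R" for u
      using that t1 t2 link_step[of s ?R t1] link_step[of s ?R t2] by auto
    have ds: "defect V s = 0"
    proof -
      have "x s t1 + x s t2 \<le> (\<Sum>u\<in>V. x s u)"
        using sum_subset_le[OF VST, of "{t1, t2}" s] t1 t2 by simp
      then show ?thesis using sum_V[OF adm s(1)] x1 t2 cap4 by linarith
    qed
    have b2: "x u v \<le> 2" if "u \<in> ?R" "v \<in> V - ?R" "v \<in> S" for u v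
    proof (cases "u = s")
      case True
      then show ?thesis using x_zero(1)[of s v] s that by simp
    next
      case False
      then have u: "u \<in> V" "u \<in> T" "2 \<le> x u s" using that t1 t2 t2T x1 x_sym by auto
      then show ?thesis using x_pair_le[OF adm, of u s v] that s cap3[OF u(2)] by auto
    qed
    have b1: "x u v \<le> 1" if "u \<in> ?R" "v \<in> V - ?R" "v \<in> T" for u v
    proof (cases "u = s")
      case True
      then show ?thesis
        using x_triple_le[OF adm, of s t1 t2 v] that s t1 t2 x1 cap4 by auto
    next
      case False
      then have "u \<in> T" using that t1 t2T by auto
      then show ?thesis using x_zero(2)[of u v] that by simp
    qed
    have root': "defect V v = 0" if "v \<in> V - ?R" "(s, v) \<in> (link V)\<^sup>*" for v
      using root that by simp
    obtain P where P: "solution (V - ?R) P" "\<forall>v. defect V v \<le> defect (V - ?R) v"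
      "\<forall>u\<in>?R. \<forall>s\<in>(V - ?R) \<inter> S. 0 < x u s \<longrightarrow>
         defect V s = 0 \<and> (\<exists>t\<in>V - ?R. [s, t] \<in> P \<and> 0 < x s t)"
      by (rule peel[OF adm RV insertI1 IH c root' b2 b1])
    show ?thesis
    proof (cases "t1 \<in> T2 \<or> t2 \<in> T2")
      case True
      have "unit_path [t1, s, t2]"
        by (rule central_path.P3) (use s t1 t2 True x_sym[of t1 s] in auto)
      then have "solution V (insert [t1, s, t2] (P - {}))"
        by (intro solution_extend[OF P(1) RV _ _ _ P(2)[rule_format]]) (use ds t1 t2T disj in auto)
      then show ?thesis by blast
    next
      case False
      \<comment> \<open>Here \<open>t2\<close> has capacity 3 and no defect but gets only 2 from
        \<open>s\<close>. So there is a further neighbour \<open>s'\<close>, whose two-vertex path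
        extends \<open>[t1, s, t2]\<close> to five vertices.\<close>
      have d2: "defect V t2 = 0" using root[of t2] link_step[of s V t2] s t2 s2 by auto
      have "(\<Sum>u\<in>V. x t2 u) = 3"
        using sum_V[OF adm t2(1)] d2 cap_T[OF t2T] False by simp
      moreover have "x t2 s \<le> 2"
        using x_pair_le[OF adm, of s t1 t2] s t1 t2 x1 cap4 x_sym[of t2 s] by simp
      ultimately obtain s' where s': "s' \<in> V - {s}" "0 < x t2 s'"
        using obtain_further[OF VST, of "{s}" t2] s by auto
      have s'S: "s' \<in> S" using x_bip[of t2 s'] s' t2T disj by auto
      have s'R: "s' \<in> V - ?R" using s' s'S t1 t2T disj by auto
      obtain t where t: "t \<in> V - ?R" "[s', t] \<in> P" "0 < x s' t" and d': "defect V s' = 0"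
        using P(3) s'R s'S s'(2) by blast
      have "unit_path [t1, s, t2, s', t]"
        by (rule central_path.P5) (use s t1 t2 s' s'S t x_sym[of t2 s'] in auto)
      then have "solution V (insert [t1, s, t2, s', t] (P - {[s', t]}))"
        by (intro solution_extend[OF P(1) RV _ _ _ P(2)[rule_format]]) (use ds t1 t t2T d' disj in auto)
      then show ?thesis by blast
    qed
  qed
qed

text \<open>A defective \<open>r\<close> lacks one unit, so it receives 1 if it is in
  \<open>T2\<close> and 2 otherwise. If one vertex sends it 2, that vertex is matched with
  \<open>r\<close>. Otherwise all its neighbours send 1; \<open>r\<close> alone is deleted and the
  two-vertex paths of one neighbour (for \<open>r \<in> T2\<close>) or of two are glued to
  it.\<close>

lemma solve_at_T:
  assumes IH: "\<And>U. U \<subset> V \<Longrightarrow> admissible U \<Longrightarrow> \<exists>P. solution U P"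
    and adm: "admissible V"
    and r: "r \<in> V" "r \<in> T" "0 < defect V r"
  shows "\<exists>P. solution V P"
proof -
  have VST: "V \<subseteq> S \<union> T" using adm by (simp add: admissible_def)
  have dr: "defect V r = 1" using adm r by (force simp: admissible_def)
  have root: "defect V v = 0" if "v \<in> V" "(r, v) \<in> (link V)\<^sup>*" "v \<noteq> r" for v
    using adm that r unfolding admissible_def by (metis gr0I)
  have sum: "(\<Sum>u\<in>V. x r u) = (if r \<in> T2 then 1 else 2)"
    using sum_V[OF adm r(1)] dr cap_T[OF r(2)] by simp
  obtain s where s: "s \<in> V" "0 < x r s"
    using obtain_further[OF VST, of "{}" r] sum by (auto split: if_splits)
  have sS: "s \<in> S" using x_bip[of r s] s r disj by auto
  have xs: "x r s \<le> (\<Sum>u\<in>V. x r u)" using sum_subset_le[OF VST, of "{s}" r] s by simp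
  show ?thesis
  proof (cases "x r s = 2")
    case True
    have "defect V v = 0" if "v \<in> V" "(s, v) \<in> (link V)\<^sup>*" "v \<noteq> s" "v \<noteq> r" for v
      using root[of v] that link_step[OF r(1) s] by (meson rtrancl_trans)
    then show ?thesis
      using solve_at_S[OF IH adm s(1) sS r(1,2)] True x_sym[of r s] by simp
  next
    case False
    then have x1: "x r s = 1" using xs s sum by (auto split: if_splits)
    let ?R = "{r}"
    have RV: "?R \<subseteq> V" using r by simp
    have c: "(r, u) \<in> (link ?R)\<^sup>*" if "u \<in> ?R" for u using that by simp
    have root': "defect V v = 0" if "v \<in> V - ?R" "(r, v) \<in> (link V)\<^sup>*" for v
      using root that by simp
    have b2: "x u v \<le> 2" if "u \<in> ?R" "v \<in> V - ?R" "v \<in> S" for u v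
      using sum_subset_le[OF VST, of "{v}" r] that sum by (auto split: if_splits)
    have b1: "x u v \<le> 1" if "u \<in> ?R" "v \<in> V - ?R" "v \<in> T" for u v
      using x_zero(2)[of u v] that r by simp
    obtain P where P: "solution (V - ?R) P" "\<forall>v. defect V v \<le> defect (V - ?R) v"
      "\<forall>u\<in>?R. \<forall>s\<in>(V - ?R) \<inter> S. 0 < x u s \<longrightarrow>
         defect V s = 0 \<and> (\<exists>t\<in>V - ?R. [s, t] \<in> P \<and> 0 < x s t)"
      by (rule peel[OF adm RV insertI1 IH c root' b2 b1])
    have sR: "s \<in> V - ?R" using s sS r disj by auto
    obtain t where t: "t \<in> V - ?R" "[s, t] \<in> P" "0 < x s t" and ds: "defect V s = 0"
      using P(3) sR sS s(2) by blast
    show ?thesis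
    proof (cases "r \<in> T2")
      case True
      have "unit_path [r, s, t]" by (rule central_path.P3) (use sS s t True x_sym[of r s] in auto)
      then have "solution V (insert [r, s, t] (P - {[s, t]}))"
        by (intro solution_extend[OF P(1) RV _ _ _ P(2)[rule_format]]) (use ds t r disj in auto)
      then show ?thesis by blast
    next
      case False
      obtain s' where s': "s' \<in> V - {s}" "0 < x r s'"
        using obtain_further[OF VST, of "{s}" r] sum s x1 False by auto
      have s'S: "s' \<in> S" using x_bip[of r s'] s' r disj by auto
      have s'R: "s' \<in> V - ?R" using s' s'S r disj by auto
      obtain t' where t': "t' \<in> V - ?R" "[s', t'] \<in> P" "0 < x s' t'" and ds': "defect V s' = 0"
        using P(3) s'R s'S s'(2) by blast
      \<comment> \<open>This yields \<open>t \<noteq> t'\<close>: the two paths differ because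
        \<open>s \<noteq> s'\<close>, so they are disjoint.\<close>
      have "set [s, t] \<inter> set [s', t'] = {}"
        using P(1) t(2) t'(2) s' unfolding solution_def by blast
      then have "unit_path [t, s, r, s', t']"
        by (intro central_path.P5) (use sS s'S s s' t t' x_sym in auto)
      then have "solution V (insert [t, s, r, s', t'] (P - {[s, t], [s', t']}))"
        by (intro solution_extend[OF P(1) RV _ _ _ P(2)[rule_format]]) (use ds ds' t t' r disj in auto)
      then show ?thesis by blast
    qed
  qed
qed

text \<open>Defective vertices of \<open>T\<close> are handled first. If there are none, the root is
  a defective vertex of \<open>S\<close>, or any vertex of \<open>S\<close> when nothing is
  defective, and its heaviest neighbour is its partner.\<close>

lemma solution_exists: "admissible V \<Longrightarrow> \<exists>P. solution V P"
proof (induction "card V" arbitrary: V rule: less_induct)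
  case less
  note adm = less.prems
  have VST: "V \<subseteq> S \<union> T" using adm by (simp add: admissible_def)
  have IH: "\<exists>P. solution U P" if "U \<subset> V" "admissible U" for U
    using less.hyps that psubset_card_mono[OF finite_sub[OF VST]] by blast
  show ?case
  proof (cases "V = {}")
    case True
    then have "solution V {}" by (simp add: solution_def)
    then show ?thesis by blast
  next
    case False
    show ?thesis
    proof (cases "\<exists>r\<in>V \<inter> T. 0 < defect V r")
      case True
      then show ?thesis using solve_at_T[OF IH adm] by blast
    next
      case noT: False
      obtain s where s: "s \<in> V" "s \<in> S"
        and rt: "\<And>v. v \<in> V \<Longrightarrow> (s, v) \<in> (link V)\<^sup>* \<Longrightarrow> v \<noteq> s \<Longrightarrow> defect V v = 0"
      proof (cases "\<exists>s\<in>V. 0 < defect V s")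
        case True
        then obtain s where s: "s \<in> V" "0 < defect V s" by blast
        then have "s \<in> S" using noT VST by auto
        then show ?thesis using that s adm unfolding admissible_def by (metis gr0I)
      next
        case no: False
        \<comment> \<open>A vertex of \<open>T\<close> without defect has positive flow within
          \<open>V\<close>, and this must come from \<open>S\<close>.\<close>
        have "V \<inter> S \<noteq> {}"
        proof
          assume emp: "V \<inter> S = {}"
          obtain t where t: "t \<in> V" "t \<in> T" using False VST emp by auto
          have "x t u = 0" if "u \<in> V" for u
            using x_zero(2)[of t u] that t emp VST by auto
          then have "(\<Sum>u\<in>V. x t u) = 0" by simp
          then show False using sum_V[OF adm t(1)] no t cap_T[OF t(2)] by (auto split: if_splits)
        qed
        then obtain s where "s \<in> V" "s \<in> S" by blast
        then show ?thesis using that[of s] no by simp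
      qed
      \<comment> \<open>The capacity of \<open>s\<close> is at least 3, so a defect of at most 2
        leaves it a neighbour in \<open>V\<close>.\<close>
      have "defect V s \<le> 2" using adm s by (auto simp: admissible_def)
      then have pos: "0 < (\<Sum>u\<in>V. x s u)" using sum_V[OF adm s(1)] cap_S[OF s(2)] by auto
      obtain t where t: "t \<in> V" "\<And>u. u \<in> V \<Longrightarrow> x s u \<le> x s t"
      proof -
        have "finite (x s ` V)" "x s ` V \<noteq> {}" using finite_sub[OF VST] s by auto
        then have "Max (x s ` V) \<in> x s ` V" "\<forall>a\<in>x s ` V. a \<le> Max (x s ` V)"
          using Max_in Max_ge by blast+
        then show ?thesis using that by (metis (no_types, lifting) image_iff)
      qed
      have xt: "0 < x s t"
      proof (rule ccontr)
        assume "\<not> 0 < x s t"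
        then have "\<forall>u\<in>V. x s u = 0" using t(2) by fastforce
        then show False using pos by simp
      qed
      have tT: "t \<in> T" using x_bip[OF xt] s disj by auto
      show ?thesis
      proof (rule solve_at_S[OF IH adm s t(1) tT xt])
        show "\<forall>u\<in>V - {t}. x s u \<le> 1" if "x s t \<le> 1"
          using t(2) that by (meson DiffD1 order_trans)
      qed (use rt in blast)+
    qed
  qed
qed

end

section \<open>From the Hall condition to a cover by paths\<close>

lemma central_path_cover:
  fixes S T1 T2 :: "'a set"
  assumes fin: "finite S" "finite T1" "finite T2"
    and disj: "S \<inter> (T1 \<union> T2) = {}" "T1 \<inter> T2 = {}"
    and card: "card S \<le> card T1 + card T2" "3 * card T1 + 2 * card T2 \<le> 4 * card S + 1"
    and E: "E \<subseteq> S \<times> (T1 \<union> T2)"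
    and hall: "\<And>X. X \<subseteq> S \<Longrightarrow>
      4 * card X \<le> 3 * card (E `` X \<inter> T1) + 2 * card (E `` X \<inter> T2) \<or> E `` X = T1 \<union> T2"
  shows "\<exists>P. (\<forall>p\<in>P. central_path E T2 p) \<and> (\<Union>p\<in>P. set p) = S \<union> (T1 \<union> T2) \<and>
    (\<forall>p\<in>P. \<forall>q\<in>P. p \<noteq> q \<longrightarrow> set p \<inter> set q = {})"
proof -
  define T where "T = T1 \<union> T2"
  have finT: "finite T" and ST: "S \<inter> T = {}" using fin disj by (auto simp: T_def)
  have cT: "card T = card T1 + card T2" unfolding T_def by (rule card_Un_disjoint) (use fin disj in auto)
  \<comment> \<open>Supply 2 on \<open>U\<close> and 3 elsewhere on \<open>T\<close>, demand 3 on \<open>D\<close> and 4 elsewhere on \<open>S\<close>: the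
    surplus is 0 or 1.\<close>
  obtain U D where U: "U \<subseteq> T2" and D: "D \<subseteq> S"
    and bal: "4 * card S + card U \<le> 3 * card T + card D" "3 * card T + card D \<le> 4 * card S + card U + 1"
  proof (cases "4 * card S < 3 * card T")
    case True
    \<comment> \<open>The weight hypothesis bounds the excess by \<open>card T2\<close> only up to
      one unit; this unit is the surplus that remains.\<close>
    then have "3 * card T - 4 * card S - 1 \<le> card T2" using card cT by linarith
    then obtain U where "U \<subseteq> T2" "card U = 3 * card T - 4 * card S - 1"
      by (meson obtain_subset_with_card_n)
    then show ?thesis using that[of U "{}"] True by simp
  next
    case False
    \<comment> \<open>The deficit is at most \<open>card S\<close> because
      \<open>card S \<le> card T\<close>, so lowering demands by one unit each makes the totals
      equal.\<close>
    then have "4 * card S - 3 * card T \<le> card S" using card cT by linarith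
    then obtain D where "D \<subseteq> S" "card D = 4 * card S - 3 * card T"
      by (meson obtain_subset_with_card_n)
    then show ?thesis using that[of "{}" D] False by simp
  qed
  define w where "w t = (if t \<in> U then 2 else 3 :: nat)" for t
  define d where "d s = (if s \<in> D then 3 else 4 :: nat)" for s
  have wsum: "sum w Y + card (Y \<inter> U) = 3 * card Y" if "finite Y" for Y
    using that by (induction Y rule: finite_induct) (auto simp: w_def)
  have dsum: "sum d X + card (X \<inter> D) = 4 * card X" if "finite X" for X
    using that by (induction X rule: finite_induct) (auto simp: d_def)
  have UT: "T \<inter> U = U" and SD: "S \<inter> D = D" using U D by (auto simp: T_def)
  have tot: "sum d S \<le> sum w T" "sum w T \<le> sum d S + 1"
    using wsum[OF finT] dsum[OF fin(1)] bal unfolding UT SD by linarith+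
  \<comment> \<open>When \<open>N(X) = T\<close>, comparing the totals is enough. Otherwise the
    original inequality applies, as supplies were only raised and demands only lowered.\<close>
  have wN: "sum d X \<le> sum w (T \<inter> E `` X)" if X: "X \<subseteq> S" for X
  proof (cases "E `` X = T1 \<union> T2")
    case True
    then have "T \<inter> E `` X = T" by (simp add: T_def)
    moreover have "sum d X \<le> sum d S" using X fin by (intro sum_mono2) auto
    ultimately show ?thesis using tot by simp
  next
    case False
    let ?N1 = "E `` X \<inter> T1" and ?N2 = "E `` X \<inter> T2"
    have "T \<inter> E `` X = ?N1 \<union> ?N2" by (auto simp: T_def)
    then have "sum w (T \<inter> E `` X) = sum w ?N1 + sum w ?N2"
      using fin disj by (simp add: sum.union_disjoint disjoint_iff)
    moreover have "sum w ?N1 = 3 * card ?N1"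
    proof -
      have "?N1 \<inter> U = {}" using U disj by auto
      then show ?thesis using wsum[of ?N1] fin by simp
    qed
    moreover have "2 * card ?N2 \<le> sum w ?N2"
      using sum_bounded_below[of ?N2 2 w] by (simp add: w_def mult.commute)
    moreover have "sum d X \<le> 4 * card X" using dsum[of X] X fin finite_subset[of X S] by simp
    ultimately show ?thesis using hall[OF X] False by linarith
  qed
  obtain f where f: "forest_flow E S T w d f"
    using weighted_hall_forest[of S T d w E] fin(1) finT ST wN by blast
  define K where "K = {(s, t). 0 < f s t}"
  have K: "K \<subseteq> E \<inter> S \<times> T" and cf: "cycle_free K"
    and fd: "\<And>s. s \<in> S \<Longrightarrow> (\<Sum>t\<in>T. f s t) = d s" and fw: "\<And>t. t \<in> T \<Longrightarrow> (\<Sum>s\<in>S. f s t) \<le> w t"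
    using f by (auto simp: forest_flow_def K_def)
  have f0: "f u v = 0" if "u \<notin> S \<or> v \<notin> T" for u v using K that by (auto simp: K_def)
  define x where "x u v = f u v + f v u" for u v
  define cap where "cap v = (if v \<in> S then d v else w v)" for v
  have xS: "(\<Sum>u\<in>S \<union> T. x s u) = d s" if "s \<in> S" for s
  proof -
    have "x s u = f s u" for u using f0[of u s] that ST by (auto simp: x_def)
    moreover have "(\<Sum>u\<in>S \<union> T. f s u) = (\<Sum>u\<in>T. f s u)"
      using fin finT f0[of s] ST by (intro sum.mono_neutral_right) auto
    ultimately show ?thesis using fd[OF that] by simp
  qed
  have xT: "(\<Sum>u\<in>S \<union> T. x t u) = (\<Sum>s\<in>S. f s t)" if "t \<in> T" for t
  proof -
    have "x t u = f u t" for u using f0[of t u] that ST by (auto simp: x_def)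
    moreover have "(\<Sum>u\<in>S \<union> T. f u t) = (\<Sum>u\<in>S. f u t)"
      using fin finT f0[of _ t] ST by (intro sum.mono_neutral_right) auto
    ultimately show ?thesis by simp
  qed
  \<comment> \<open>The vertices of \<open>T2\<close> outside \<open>U\<close> have supply 3 and are
    treated like \<open>T1\<close>. A three-vertex path then meets \<open>U\<close>, and hence
    \<open>T2\<close>.\<close>
  interpret balanced_forest S T U cap x
  proof
    show "finite S" "finite T" "S \<inter> T = {}" by (fact fin(1) finT ST)+
    show "cap s = 3 \<or> cap s = 4" if "s \<in> S" for s using that by (simp add: cap_def d_def)
    show "cap t = (if t \<in> U then 2 else 3)" if "t \<in> T" for t
      using that ST by (auto simp: cap_def w_def)
    show "x u v = x v u" for u v by (simp add: x_def)
    show "u \<in> S \<and> v \<in> T \<or> u \<in> T \<and> v \<in> S" if "0 < x u v" for u v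
    proof -
      have "(u, v) \<in> K \<or> (v, u) \<in> K" using that by (auto simp: x_def K_def)
      then show ?thesis using K by blast
    qed
    show "(\<Sum>u\<in>S \<union> T. x v u) \<le> cap v" if "v \<in> S \<union> T" for v
      using that xS[of v] xT[of v] fw[of v] ST by (auto simp: cap_def)
    show "(a, b) \<notin> {(u, v). 0 < x u v \<and> {u, v} \<noteq> {a, b}}\<^sup>*" if "0 < x a b" for a b
    proof
      assume path: "(a, b) \<in> {(u, v). 0 < x u v \<and> {u, v} \<noteq> {a, b}}\<^sup>*"
      \<comment> \<open>The walk avoids the edge between \<open>a\<close> and \<open>b\<close> in
        both directions, so it works for whichever orientation belongs to \<open>K\<close>.\<close>
      have "(a, b) \<in> conn (K - {e})" if "e = (a, b) \<or> e = (b, a)" for e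
        unfolding conn_def
        by (rule subsetD[OF rtrancl_mono path])
          (use that in \<open>auto simp: x_def K_def\<close>)
      then have "(a, b) \<in> conn (K - {(a, b)})" "(b, a) \<in> conn (K - {(b, a)})"
        using conn_sym by metis+
      moreover have "(a, b) \<in> K \<or> (b, a) \<in> K" using that by (auto simp: x_def K_def)
      ultimately show False using cf by (auto simp: cycle_free_def)
    qed
  qed
  have defS: "defect (S \<union> T) s = 0" if "s \<in> S" for s
    using xS[OF that] that by (simp add: defect_def cap_def)
  have defT: "defect (S \<union> T) t + (\<Sum>s\<in>S. f s t) = w t" if "t \<in> T" for t
    using xT[OF that] fw[OF that] that ST by (auto simp: defect_def cap_def)
  \<comment> \<open>All demands are met exactly, so the defects on \<open>T\<close> add up to total
    supply minus total demand. This is at most 1, hence at most one vertex is defective.\<close>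
  have "(\<Sum>t\<in>T. defect (S \<union> T) t) + (\<Sum>t\<in>T. \<Sum>s\<in>S. f s t) = sum w T"
    using defT by (simp flip: sum.distrib)
  moreover have "(\<Sum>t\<in>T. \<Sum>s\<in>S. f s t) = sum d S"
    using fd by (subst sum.swap) simp
  ultimately have surplus: "(\<Sum>t\<in>T. defect (S \<union> T) t) \<le> 1" using tot by simp
  have dT1: "defect (S \<union> T) t \<le> 1" if "t \<in> T" for t
    using member_le_sum[OF that, of "defect (S \<union> T)"] surplus finT by simp
  have "u = v" if "u \<in> S \<union> T" "v \<in> S \<union> T" "0 < defect (S \<union> T) u" "0 < defect (S \<union> T) v" for u v
  proof (rule ccontr)
    assume "u \<noteq> v"
    have "{u, v} \<subseteq> T" using that defS by auto
    then have "(\<Sum>t\<in>{u, v}. defect (S \<union> T) t) \<le> 1"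
      using sum_mono2[OF finT, of "{u, v}" "defect (S \<union> T)"] surplus by simp
    then show False using \<open>u \<noteq> v\<close> that by simp
  qed
  then have "admissible (S \<union> T)" using defS dT1 by (simp add: admissible_def)
  then obtain P where P: "solution (S \<union> T) P" using solution_exists by blast
  have "f t s = 0" if "s \<in> S" for s t using f0[of t s] that ST by auto
  then have sub: "{(s, t). s \<in> S \<and> 0 < x s t} \<subseteq> E" using K by (auto simp: x_def K_def)
  have "central_path E T2 p" if "p \<in> P" for p
  proof (rule central_path_mono[OF _ sub U])
    show "unit_path p" using P that by (simp add: solution_def)
  qed
  moreover have "(\<Union>p\<in>P. set p) = S \<union> (T1 \<union> T2)"
    "\<forall>p\<in>P. \<forall>q\<in>P. p \<noteq> q \<longrightarrow> set p \<inter> set q = {}"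
    using P by (simp_all add: solution_def T_def)
  ultimately show ?thesis by (intro exI[of _ P]) simp
qed

section \<open>Path-factors\<close>

definition path_union :: "'a list set \<Rightarrow> 'a pair_pre_digraph" where
  "path_union P = \<lparr>pverts = (\<Union>p\<in>P. set p),
     parcs = (\<Union>p\<in>P. set (vwalk_arcs p) \<union> (set (vwalk_arcs p))\<inverse>)\<rparr>"

lemma vwalk_arcs_in_set: "(u, v) \<in> set (vwalk_arcs p) \<Longrightarrow> u \<in> set p \<and> v \<in> set p"
  by (induction p rule: vwalk_arcs.induct) auto

lemma vwalk_arcs_neq: "distinct p \<Longrightarrow> (u, v) \<in> set (vwalk_arcs p) \<Longrightarrow> u \<noteq> v"
  by (induction p rule: vwalk_arcs.induct) auto

lemma hd_reaches: "v \<in> set p \<Longrightarrow> (hd p, v) \<in> (set (vwalk_arcs p))\<^sup>*"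
proof (induction p rule: vwalk_arcs.induct)
  case (3 x y xs)
  show ?case
  proof (cases "v = x")
    case False
    then have "(y, v) \<in> (set (vwalk_arcs (y # xs)))\<^sup>*" using 3 by simp
    then have "(y, v) \<in> (set (vwalk_arcs (x # y # xs)))\<^sup>*"
      by (rule subsetD[OF rtrancl_mono, rotated]) auto
    then show ?thesis by (auto intro: converse_rtrancl_into_rtrancl)
  qed auto
qed auto

lemma pair_graph_path_union:
  assumes "finite (\<Union>p\<in>P. set p)" "\<And>p. p \<in> P \<Longrightarrow> distinct p"
  shows "pair_graph (path_union P)"
proof -
  let ?F = "path_union P"
  have finV: "finite (pverts ?F)" using assms(1) by (simp add: path_union_def)
  have sub: "parcs ?F \<subseteq> pverts ?F \<times> pverts ?F"
    by (auto simp: path_union_def dest: vwalk_arcs_in_set)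
  then have "finite (parcs ?F)"
    by (rule finite_subset) (use finV in simp)
  moreover have "sym (parcs ?F)" unfolding sym_def path_union_def by auto
  moreover have "u \<noteq> v" if "(u, v) \<in> parcs ?F" for u v
    using that assms(2) vwalk_arcs_neq by (fastforce simp: path_union_def)
  ultimately show ?thesis
    using sub finV by unfold_locales (auto simp: symmetric_def)
qed

text \<open>The paths are disjoint, so a walk cannot leave the path where it starts. Conversely the
  head of a path reaches all of it, and symmetry makes this strong connectivity.\<close>

lemma component_path_union:
  assumes fin: "finite (\<Union>p\<in>P. set p)" and dist: "\<And>p. p \<in> P \<Longrightarrow> distinct p"
    and disj: "\<And>p q. p \<in> P \<Longrightarrow> q \<in> P \<Longrightarrow> p \<noteq> q \<Longrightarrow> set p \<inter> set q = {}"
    and A: "A \<in> components (path_union P)"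
  obtains p where "p \<in> P" "verts A = set p" "is_path_graph A"
proof -
  let ?F = "path_union P"
  interpret pair_graph ?F using pair_graph_path_union[OF fin dist] .
  obtain u where u: "u \<in> pverts ?F" "A = with_proj ?F \<restriction> scc_of u"
    using A unfolding sccs_conv_sccs_verts sccs_verts_conv_scc_of by auto
  then obtain p where p: "p \<in> P" "u \<in> set p" by (auto simp: path_union_def)
  have same: "q = p" if "q \<in> P" "v \<in> set q" "v \<in> set p" for q v
    using disj[of q p] that p by blast
  have stay: "v \<in> set p" if "u \<rightarrow>\<^sup>*\<^bsub>with_proj ?F\<^esub> v" for v
  proof -
    have "(u, v) \<in> (parcs ?F)\<^sup>*" using reachable_rtranclI[OF that] by simp
    then show ?thesis
    proof (induction rule: rtrancl_induct)
      case (step y z)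
      then obtain q where "q \<in> P" "(y, z) \<in> set (vwalk_arcs q) \<or> (z, y) \<in> set (vwalk_arcs q)"
        by (auto simp: path_union_def)
      then show ?case using same[of q y] step.IH vwalk_arcs_in_set by metis
    qed (rule p)
  qed
  have arcs: "set (vwalk_arcs p) \<subseteq> parcs ?F" using p by (auto simp: path_union_def)
  have hd: "hd p \<rightarrow>\<^sup>*\<^bsub>with_proj ?F\<^esub> v" if "v \<in> set p" for v
  proof -
    have "hd p \<in> set p" using that by (cases p) auto
    then have "hd p \<in> pverts ?F" using p by (auto simp: path_union_def)
    have "(hd p, v) \<in> (parcs ?F)\<^sup>*"
      using subsetD[OF rtrancl_mono[OF arcs] hd_reaches[OF that]] .
    then show ?thesis
    proof (induction rule: rtrancl_induct)
      case base
      show ?case using \<open>hd p \<in> pverts ?F\<close> by (rule reachable_refl)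
    next
      case (step y z)
      then show ?case using reachable_adj_trans by simp
    qed
  qed
  have "scc_of u = set p"
    unfolding scc_of_def using stay hd p(2) symmetric_reachable[OF sym_arcs] by (blast intro: reachable_trans)
  then have A: "A = with_proj ?F \<restriction> set p" using u by simp
  have "arcs_ends A = set (vwalk_arcs p) \<union> (set (vwalk_arcs p))\<inverse>"
  proof -
    have "arcs_ends A = {(a, b) \<in> parcs ?F. a \<in> set p \<and> b \<in> set p}"
      unfolding A arcs_ends_conv by force
    also have "\<dots> = set (vwalk_arcs p) \<union> (set (vwalk_arcs p))\<inverse>"
      using same p vwalk_arcs_in_set by (fastforce simp: path_union_def)
    finally show ?thesis .
  qed
  moreover have "verts A = set p" by (simp add: A)
  moreover have "p \<noteq> []" using p by auto
  ultimately have "is_path_graph A"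
    unfolding is_path_graph_def vpath_def vwalk_def using dist[OF p(1)] by blast
  then show ?thesis using that p(1) \<open>verts A = set p\<close> by blast
qed

lemma central_path_props:
  assumes "central_path E T2 p" "E \<subseteq> S \<times> T" "S \<inter> T = {}"
  shows "distinct p" "set (vwalk_arcs p) \<subseteq> E \<union> E\<inverse>" "2 \<le> card (set p)"
    "card (set p \<inter> S) \<le> card (set p \<inter> T)" "card (set p) = 3 \<Longrightarrow> set p \<inter> T2 \<noteq> {}"
proof -
  have ST: "s \<in> S \<and> s \<notin> T \<and> t \<in> T \<and> t \<notin> S \<and> s \<noteq> t" if "(s, t) \<in> E" for s t
    using that assms(2,3) by auto
  show d: "distinct p" using assms(1) by cases (auto dest: ST)
  show "set (vwalk_arcs p) \<subseteq> E \<union> E\<inverse>" using assms(1) by cases auto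
  show "2 \<le> card (set p)" using assms(1) unfolding distinct_card[OF d] by cases auto
  show "card (set p \<inter> S) \<le> card (set p \<inter> T)" using assms(1) d by cases (auto dest!: ST)
  show "card (set p) = 3 \<Longrightarrow> set p \<inter> T2 \<noteq> {}"
    using assms(1) unfolding distinct_card[OF d] by cases auto
qed

theorem theorem2:
  fixes G :: "'a pair_pre_digraph" and S T1 T2 T :: "'a set"
  assumes "finite S" and "finite T1" and "finite T2"
    and "S \<inter> T1 = {}" and "S \<inter> T2 = {}" and "T1 \<inter> T2 = {}"
    and "1 \<le> card S" and "card S \<le> card T1 + card T2"
    and "real (card T1) + 2 / 3 * real (card T2) \<le> 4 / 3 * real (card S) + 1 / 3"
    and "T = T1 \<union> T2"
    and "bipartite_graph G S T"
    and "\<forall>X\<subseteq>S.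
           real (card (set_nbhd G X \<inter> T1)) + 2 / 3 * real (card (set_nbhd G X \<inter> T2))
             \<ge> 4 / 3 * real (card X)
           \<or> set_nbhd G X = T"
  shows "\<exists>F. path_factor F G \<and> central G S T F \<and>
             (\<forall>A\<in>components F. card (verts A) = 3 \<longrightarrow> verts A \<inter> T2 \<noteq> {})"
proof -
  note T = assms(10)
  have G: "pair_graph G" "pverts G = S \<union> T" "S \<inter> T = {}" "parcs G \<subseteq> S \<times> T \<union> T \<times> S"
    using assms(11) by (auto simp: bipartite_graph_def)
  interpret G: pair_graph G by fact
  define E where "E = parcs G \<inter> S \<times> T"
  \<comment> \<open>For \<open>X \<subseteq> S\<close> all neighbours lie in \<open>T\<close>, so
    subtracting \<open>X\<close> in \<open>set_nbhd\<close> removes nothing.\<close>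
  have nb: "set_nbhd G X = E `` X" if "X \<subseteq> S" for X
    using that G(3,4) by (auto simp: set_nbhd_def nbhd_def E_def)
  \<comment> \<open>Multiplying by 3 turns the real weights into natural numbers.\<close>
  have hall: "4 * card X \<le> 3 * card (E `` X \<inter> T1) + 2 * card (E `` X \<inter> T2) \<or> E `` X = T1 \<union> T2"
    if "X \<subseteq> S" for X
  proof -
    have "real (4 * card X) \<le> real (3 * card (E `` X \<inter> T1) + 2 * card (E `` X \<inter> T2)) \<or> E `` X = T"
      using assms(12)[rule_format, OF that] unfolding nb[OF that] by auto
    then show ?thesis unfolding T of_nat_le_iff .
  qed
  have weight: "3 * card T1 + 2 * card T2 \<le> 4 * card S + 1"
  proof -
    have "real (3 * card T1 + 2 * card T2) \<le> real (4 * card S + 1)" using assms(9) by simp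
    then show ?thesis unfolding of_nat_le_iff .
  qed
  have "E \<subseteq> S \<times> (T1 \<union> T2)" "S \<inter> (T1 \<union> T2) = {}" using G(3) T by (auto simp: E_def)
  from central_path_cover[OF assms(1-3) this(2) assms(6,8) weight this(1) hall]
  obtain P where "\<forall>p\<in>P. central_path E T2 p" "(\<Union>p\<in>P. set p) = S \<union> T"
    "\<forall>p\<in>P. \<forall>q\<in>P. p \<noteq> q \<longrightarrow> set p \<inter> set q = {}"
    unfolding T by auto
  note P = this(1)[rule_format] this(2) and disj = this(3)[rule_format]
  have "E \<subseteq> S \<times> T" by (simp add: E_def)
  note props = central_path_props[OF P(1) this G(3)]
  have fin: "finite (\<Union>p\<in>P. set p)" using P(2) assms(1-3) T by simp
  let ?F = "path_union P"
  have pg: "pair_graph ?F" using pair_graph_path_union[OF fin props(1)] .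
  interpret F: pair_graph ?F by fact
  have vF: "pverts ?F = S \<union> T" using P(2) by (simp add: path_union_def)
  have "E \<union> E\<inverse> \<subseteq> parcs G" using G.arcs_symmetric by (auto simp: E_def)
  then have "parcs ?F \<subseteq> parcs G" using props(2) by (fastforce simp: path_union_def)
  then have sub: "subgraph ?F G"
    using vF G(2) G.wf_digraph F.wf_digraph by (simp add: subgraph_def compatible_def)
  have comp: "is_path_graph A \<and> 2 \<le> card (verts A) \<and> card (verts A \<inter> S) \<le> card (verts A \<inter> T) \<and>
      (card (verts A) = 3 \<longrightarrow> verts A \<inter> T2 \<noteq> {})" if A: "A \<in> components ?F" for A
  proof -
    obtain p where "p \<in> P" "verts A = set p" "is_path_graph A"
      by (rule component_path_union[OF fin props(1) disj A])
    then show ?thesis using props(3-5)[of p] by simp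
  qed
  have "path_factor ?F G" "central G S T ?F"
    using comp sub pg vF G(2)
    by (auto simp: path_factor_def central_def simple_subgraph_def spanning_def)
  then show ?thesis using comp by blast
qed

end
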